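(* Let $d\ge 1$ and let $H$ be a $d$-regular graph that has BEL gadgets. Suppose there exists a vertex $v\in V(H)$ such that $N(v)$ is an independent set and $H-v-N(v)$ (the graph obtained from $H$ by deleting $v$ and all its neighbors) is connected. Then $s(H)=2d-1$.
   Context: All graphs are finite and simple; a copy of a graph means a (not necessarily induced) subgraph isomorphic to it. For graphs $F,H$, write $F\to H$ if every 2-coloring (red/blue) of the edges of $F$ contains a monochromatic copy of $H$, and $F\not\to H$ otherwise. $F$ is Ramsey $H$-minimal if $F\to H$ and no proper subgraph $F'$ of $F$ satisfies $F'\to H$; $\mathcal{M}(H)$ denotes the set of such graphs, and $s(H)=\min_{F\in\mathcal{M}(H)}\delta(F)$ with $\delta(F)$ the minimum degree. A graph $H$ has BEL gadgets if for every graph $G$ and every 2-coloring $\psi$ of the edges of $G$ without a monochromatic copy of $H$, there is a graph $F$ such that (1) $F\not\to H$, (2) $F$ contains $G$ as an induced subgraph, and (3) for every 2-coloring of the edges of $F$ without a monochromatic copy of $H$, its restriction to $G$ agrees with $\psi$ up to swapping the two colors. *)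

theory Defs
  imports Main
begin

record 'a sgraph =
  verts :: "'a set"
  edges :: "'a set set"

definition simple_graph :: "'a sgraph \<Rightarrow> bool" where
  "simple_graph G \<longleftrightarrow> finite (verts G) \<and>
     edges G \<subseteq> {{u, v} | u v. u \<in> verts G \<and> v \<in> verts G \<and> u \<noteq> v}"

definition subgraph :: "'a sgraph \<Rightarrow> 'a sgraph \<Rightarrow> bool" where
  "subgraph K G \<longleftrightarrow> simple_graph K \<and> simple_graph G \<and>
     verts K \<subseteq> verts G \<and> edges K \<subseteq> edges G"

definition induced :: "'a sgraph \<Rightarrow> 'a set \<Rightarrow> 'a sgraph" where
  "induced G S = \<lparr>verts = verts G \<inter> S, edges = {e \<in> edges G. e \<subseteq> S}\<rparr>"

definition induced_subgraph :: "'a sgraph \<Rightarrow> 'a sgraph \<Rightarrow> bool" where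
  "induced_subgraph K G \<longleftrightarrow> subgraph K G \<and> K = induced G (verts K)"

definition delete_verts :: "'a sgraph \<Rightarrow> 'a set \<Rightarrow> 'a sgraph" where
  "delete_verts G S = induced G (verts G - S)"

definition isomorphic :: "'a sgraph \<Rightarrow> 'b sgraph \<Rightarrow> bool" where
  "isomorphic G H \<longleftrightarrow>
     (\<exists>f. bij_betw f (verts G) (verts H) \<and> (\<lambda>e. f ` e) ` edges G = edges H)"

definition neighbors :: "'a sgraph \<Rightarrow> 'a \<Rightarrow> 'a set" where
  "neighbors G v = {u. {u, v} \<in> edges G}"

definition vdegree :: "'a sgraph \<Rightarrow> 'a \<Rightarrow> nat" where
  "vdegree G v = card (neighbors G v)"

definition min_degree :: "'a sgraph \<Rightarrow> nat" where
  "min_degree G = Min (vdegree G ` verts G)"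

definition regular_graph :: "nat \<Rightarrow> 'a sgraph \<Rightarrow> bool" where
  "regular_graph d G \<longleftrightarrow> (\<forall>v \<in> verts G. vdegree G v = d)"

definition independent_set :: "'a sgraph \<Rightarrow> 'a set \<Rightarrow> bool" where
  "independent_set G S \<longleftrightarrow> S \<subseteq> verts G \<and> (\<forall>u \<in> S. \<forall>v \<in> S. {u, v} \<notin> edges G)"

text \<open>The graph without vertices counts as connected.\<close>

definition connected_graph :: "'a sgraph \<Rightarrow> bool" where
  "connected_graph G \<longleftrightarrow>
     (\<forall>u \<in> verts G. \<forall>v \<in> verts G. (u, v) \<in> {(x, y). {x, y} \<in> edges G}\<^sup>*)"

text \<open>A 2-coloring of the edges of a graph is a function on all vertex sets, of which only
  the values on edges are ever used; the two colors are the truth values.\<close>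

type_synonym 'a coloring = "'a set \<Rightarrow> bool"

definition monochromatic :: "'a coloring \<Rightarrow> 'a sgraph \<Rightarrow> bool" where
  "monochromatic c K \<longleftrightarrow> (\<exists>b. \<forall>e \<in> edges K. c e = b)"

definition has_mono_copy :: "'a coloring \<Rightarrow> 'a sgraph \<Rightarrow> 'b sgraph \<Rightarrow> bool" where
  "has_mono_copy c F H \<longleftrightarrow> (\<exists>K. subgraph K F \<and> isomorphic K H \<and> monochromatic c K)"

definition arrows :: "'a sgraph \<Rightarrow> 'b sgraph \<Rightarrow> bool" where
  "arrows F H \<longleftrightarrow> (\<forall>c. has_mono_copy c F H)"

text \<open>Finite graphs are taken, up to isomorphism, on vertices of type \<^typ>\<open>nat\<close>.\<close>

definition ramsey_minimal_graphs :: "'b sgraph \<Rightarrow> nat sgraph set" where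
  "ramsey_minimal_graphs H =
     {F. simple_graph F \<and> arrows F H \<and>
         (\<forall>F'. subgraph F' F \<and> F' \<noteq> F \<longrightarrow> \<not> arrows F' H)}"

definition ramsey_s :: "'b sgraph \<Rightarrow> nat" where
  "ramsey_s H = Inf (min_degree ` ramsey_minimal_graphs H)"

definition has_BEL_gadgets :: "'b sgraph \<Rightarrow> bool" where
  "has_BEL_gadgets H \<longleftrightarrow>
     (\<forall>(G :: nat sgraph) (\<psi> :: nat coloring).
        simple_graph G \<and> \<not> has_mono_copy \<psi> G H \<longrightarrow>
        (\<exists>F :: nat sgraph. simple_graph F \<and>
           \<not> arrows F H \<and>
           induced_subgraph G F \<and>
           (\<forall>c. \<not> has_mono_copy c F H \<longrightarrow>
              (\<forall>e \<in> edges G. c e = \<psi> e) \<or> (\<forall>e \<in> edges G. c e = (\<not> \<psi> e)))))"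

end

theory Submission
  imports Defs
begin

text \<open>Lower bound: if a vertex \<open>w\<close> of a minimal \<open>F\<close> had degree at most \<open>2 d - 2\<close>, a good coloring of
  \<open>F - w\<close> would extend by giving at most \<open>d - 1\<close> of the edges at \<open>w\<close> each color, and \<open>w\<close> could then
  lie on no monochromatic graph of minimum degree \<open>d\<close>.

  Upper bound: build a colored graph in which every \<open>d\<close>-subset \<open>S\<close> of \<open>2 d - 1\<close> independent vertices
  is, in each color, the image of \<open>N(v)\<close> under a copy of \<open>H - v\<close>. It has no monochromatic copy of
  \<open>H\<close>: by regularity and connectedness such a copy would contain each private part
  \<open>H - v - N(v)\<close> entirely or not at all, and one part leaves it too few vertices, two parts too
  many. A BEL gadget forces this coloring up to swapping colors; a new vertex joined to the
  \<open>2 d - 1\<close> vertices sends \<open>d\<close> edges of one color to some \<open>S\<close> and so completes a copy of \<open>H\<close>. Every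
  minimal subgraph of the result must contain the new vertex.\<close>

section \<open>Halving a finite set\<close>

lemma ex_subset_and_complement_card_less:
  fixes d :: nat
  assumes "finite A" "card A < 2 * d - 1"
  shows "\<exists>B \<subseteq> A. card B < d \<and> card (A - B) < d"
proof -
  obtain B where "B \<subseteq> A" and card_B: "card B = min (d - 1) (card A)"
    using obtain_subset_with_card_n[of "min (d - 1) (card A)" A] by auto
  then have "card (A - B) = card A - min (d - 1) (card A)"
    using assms(1) by (simp add: card_Diff_subset finite_subset)
  then have "card B < d \<and> card (A - B) < d"
    using card_B assms(2) by linarith
  with \<open>B \<subseteq> A\<close> show ?thesis
    by blast
qed

lemma ex_monochromatic_subset:
  fixes d :: nat and P :: "'a \<Rightarrow> bool"
  assumes "finite A" "2 * d - 1 \<le> card A"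
  shows "\<exists>S \<subseteq> A. \<exists>b. card S = d \<and> (\<forall>x\<in>S. P x = b)"
proof -
  let ?class = "\<lambda>b. {x \<in> A. P x = b}"
  have "\<exists>b. d \<le> card (?class b)"
  proof (rule ccontr)
    assume "\<nexists>b. d \<le> card (?class b)"
    then have class_small: "card (?class b) < d" for b
      by (simp add: not_le)
    have "card A = card (?class True \<union> ?class False)"
      by (rule arg_cong[of _ _ card]) auto
    also have "\<dots> \<le> card (?class True) + card (?class False)"
      by (rule card_Un_le)
    finally show False
      using class_small[of True] class_small[of False] assms by linarith
  qed
  then obtain b where "d \<le> card (?class b)" ..
  then obtain S where "S \<subseteq> ?class b" "card S = d"
    by (rule obtain_subset_with_card_n)
  then have "S \<subseteq> A" "\<forall>x\<in>S. P x = b"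
    by auto
  with \<open>card S = d\<close> show ?thesis
    by blast
qed

section \<open>Simple graphs\<close>

lemma simple_graph_edgeD:
  assumes "simple_graph G" "{u, v} \<in> edges G"
  shows "u \<in> verts G" "v \<in> verts G" "u \<noteq> v"
  using assms by (auto simp: simple_graph_def doubleton_eq_iff dest!: subsetD)

lemma simple_graph_edgeE:
  assumes "simple_graph G" "e \<in> edges G"
  obtains u v where "e = {u, v}" "u \<in> verts G" "v \<in> verts G" "u \<noteq> v"
  using assms by (auto simp: simple_graph_def)

lemma simple_graph_edge_subset: "simple_graph G \<Longrightarrow> e \<in> edges G \<Longrightarrow> e \<subseteq> verts G"
  by (auto elim: simple_graph_edgeE)

lemma simple_graph_finite_verts: "simple_graph G \<Longrightarrow> finite (verts G)"
  by (simp add: simple_graph_def)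

lemma simple_graph_finite_edges: "simple_graph G \<Longrightarrow> finite (edges G)"
  by (rule finite_subset[of _ "Pow (verts G)"]) (auto simp: simple_graph_def)

lemma in_neighbors_commute: "u \<in> neighbors G v \<longleftrightarrow> v \<in> neighbors G u"
  by (simp add: neighbors_def insert_commute)

lemma neighbors_subset_verts: "simple_graph G \<Longrightarrow> neighbors G v \<subseteq> verts G"
  by (auto simp: neighbors_def dest: simple_graph_edgeD)

lemma finite_neighbors: "simple_graph G \<Longrightarrow> finite (neighbors G v)"
  using neighbors_subset_verts simple_graph_finite_verts by (rule finite_subset)

lemma not_in_own_neighbors: "simple_graph G \<Longrightarrow> v \<notin> neighbors G v"
  using simple_graph_edgeD(3)[of G v v] by (auto simp: neighbors_def)

lemma incident_edgeE:
  assumes "simple_graph G" "e \<in> edges G" "v \<in> e"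
  obtains u where "u \<in> neighbors G v" "e = {u, v}"
proof -
  obtain x y where "e = {x, y}"
    using assms(1,2) by (rule simple_graph_edgeE)
  then have "e = {x, v} \<or> e = {y, v}"
    using assms(3) by auto
  then show thesis
    using that assms(2) by (auto simp: neighbors_def)
qed

lemma connected_graph_verts_subset:
  assumes "connected_graph G" "x \<in> verts G" "x \<in> X"
    and closed: "\<And>y z. y \<in> X \<Longrightarrow> {y, z} \<in> edges G \<Longrightarrow> z \<in> X"
  shows "verts G \<subseteq> X"
proof
  fix y assume "y \<in> verts G"
  then have "(x, y) \<in> {(x, y). {x, y} \<in> edges G}\<^sup>*"
    using assms(1,2) by (simp add: connected_graph_def)
  then show "y \<in> X"
    by (induction rule: rtrancl_induct) (use assms(3) closed in auto)
qed

lemma subgraph_refl: "simple_graph G \<Longrightarrow> subgraph G G"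
  by (simp add: subgraph_def)

lemma subgraph_trans: "subgraph A B \<Longrightarrow> subgraph B C \<Longrightarrow> subgraph A C"
  by (auto simp: subgraph_def)

lemma subgraph_antisym: "subgraph A B \<Longrightarrow> subgraph B A \<Longrightarrow> A = B"
  by (auto simp: subgraph_def intro!: sgraph.equality)

lemma subgraph_vdegree_le:
  assumes "subgraph K G"
  shows "vdegree K v \<le> vdegree G v"
  unfolding vdegree_def
  using assms by (intro card_mono finite_neighbors) (auto simp: neighbors_def subgraph_def)

lemma delete_verts_simps:
  "verts (delete_verts G S) = verts G - S"
  "edges (delete_verts G S) = {e \<in> edges G. e \<subseteq> verts G - S}"
  by (auto simp: delete_verts_def induced_def)

lemma simple_graph_delete_verts:
  assumes "simple_graph G"
  shows "simple_graph (delete_verts G S)"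
  using assms unfolding simple_graph_def delete_verts_simps by (auto, blast)

lemma subgraph_delete_verts: "simple_graph G \<Longrightarrow> subgraph (delete_verts G S) G"
  using simple_graph_delete_verts by (auto simp: subgraph_def delete_verts_simps)

lemma subgraph_delete_vertsI:
  assumes "subgraph K G" "verts K \<inter> S = {}"
  shows "subgraph K (delete_verts G S)"
proof -
  have "e \<subseteq> verts G - S" if "e \<in> edges K" for e
    using assms simple_graph_edge_subset[OF _ that] by (auto simp: subgraph_def)
  then show ?thesis
    using assms simple_graph_delete_verts by (auto simp: subgraph_def delete_verts_simps)
qed

definition map_sgraph :: "('a \<Rightarrow> 'b) \<Rightarrow> 'a sgraph \<Rightarrow> 'b sgraph" where
  "map_sgraph f G = \<lparr>verts = f ` verts G, edges = (`) f ` edges G\<rparr>"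

lemma simple_graph_map:
  assumes "simple_graph G" "inj_on f (verts G)"
  shows "simple_graph (map_sgraph f G)"
  unfolding simple_graph_def
proof (intro conjI subsetI)
  show "finite (verts (map_sgraph f G))"
    using assms(1) by (simp add: simple_graph_def map_sgraph_def)
next
  fix e assume "e \<in> edges (map_sgraph f G)"
  then obtain e' where "e' \<in> edges G" "e = f ` e'"
    by (auto simp: map_sgraph_def)
  moreover obtain u v where "e' = {u, v}" "u \<in> verts G" "v \<in> verts G" "u \<noteq> v"
    using assms(1) \<open>e' \<in> edges G\<close> by (rule simple_graph_edgeE)
  ultimately have "e = {f u, f v}" "f u \<noteq> f v"
    "f u \<in> verts (map_sgraph f G)" "f v \<in> verts (map_sgraph f G)"
    using assms(2) by (auto simp: map_sgraph_def inj_on_eq_iff)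
  then show "e \<in> {{u, v} |u v. u \<in> verts (map_sgraph f G) \<and> v \<in> verts (map_sgraph f G) \<and> u \<noteq> v}"
    by blast
qed

lemma map_sgraph_inv_into:
  assumes "simple_graph G" "inj_on f (verts G)"
  shows "map_sgraph (inv_into (verts G) f) (map_sgraph f G) = G"
proof -
  have "inv_into (verts G) f ` f ` e = e" if "e \<in> edges G" for e
    using assms(2) simple_graph_edge_subset[OF assms(1) that] by (rule inv_into_image_cancel)
  then show ?thesis
    using assms(2) by (simp add: map_sgraph_def image_image)
qed

lemma isomorphic_map:
  assumes "simple_graph H" "inj_on g (verts H)"
  shows "isomorphic (map_sgraph g H) H"
proof -
  let ?h = "inv_into (verts H) g"
  have "(`) ?h ` edges (map_sgraph g H) = edges H"
    using arg_cong[OF map_sgraph_inv_into[OF assms], of edges] by (simp add: map_sgraph_def)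
  moreover have "bij_betw ?h (verts (map_sgraph g H)) (verts H)"
    using assms(2) by (simp add: map_sgraph_def bij_betw_inv_into inj_on_imp_bij_betw)
  ultimately show ?thesis
    unfolding isomorphic_def by blast
qed

definition add_vertex :: "'a \<Rightarrow> 'a set \<Rightarrow> 'a sgraph \<Rightarrow> 'a sgraph" where
  "add_vertex w A G = \<lparr>verts = insert w (verts G), edges = edges G \<union> (\<lambda>a. {a, w}) ` A\<rparr>"

lemma simple_graph_add_vertex:
  assumes "simple_graph G" "w \<notin> verts G" "A \<subseteq> verts G"
  shows "simple_graph (add_vertex w A G)"
  using assms unfolding simple_graph_def add_vertex_def by fastforce

lemma subgraph_add_vertex:
  assumes "subgraph K G" "w \<notin> verts G" "A \<subseteq> verts K"
  shows "subgraph (add_vertex w A K) (add_vertex w A G)"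
proof -
  have "simple_graph (add_vertex w A K)" "simple_graph (add_vertex w A G)"
    using assms by (auto intro!: simple_graph_add_vertex simp: subgraph_def)
  then show ?thesis
    using assms(1) by (auto simp: subgraph_def add_vertex_def)
qed

lemma delete_add_vertex:
  assumes "simple_graph G" "w \<notin> verts G"
  shows "delete_verts (add_vertex w A G) {w} = G"
  using assms simple_graph_edge_subset[OF assms(1)]
  by (auto intro!: sgraph.equality simp: delete_verts_simps add_vertex_def)

lemma subgraph_add_vertex_self:
  assumes "simple_graph G" "w \<notin> verts G" "A \<subseteq> verts G"
  shows "subgraph G (add_vertex w A G)"
  using subgraph_delete_verts[OF simple_graph_add_vertex[OF assms]] delete_add_vertex[OF assms(1,2)]
  by metis

lemma vdegree_add_vertex:
  assumes "simple_graph G" "w \<notin> verts G" "A \<subseteq> verts G"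
  shows "vdegree (add_vertex w A G) w = card A"
proof -
  have "neighbors (add_vertex w A G) w = A"
    using assms simple_graph_edge_subset[OF assms(1)]
    by (auto simp: neighbors_def add_vertex_def doubleton_eq_iff)
  then show ?thesis
    by (simp add: vdegree_def)
qed

lemma map_sgraph_add_vertex:
  assumes "simple_graph G" "w \<notin> verts G" "A \<subseteq> verts G"
  shows "map_sgraph (f(w := u)) (add_vertex w A G) = add_vertex u (f ` A) (map_sgraph f G)"
proof -
  have agree: "f(w := u) ` X = f ` X" if "X \<subseteq> verts G" for X
    using assms(2) that by (auto simp only: fun_upd_image split: if_splits)
  have "f(w := u) ` insert w (verts G) = insert u (f ` verts G)"
    using agree[of "verts G"] by (metis fun_upd_same image_insert subset_refl)
  moreover have "(`) (f(w := u)) ` edges G = (`) f ` edges G"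
    by (rule image_cong[OF refl], rule agree) (rule simple_graph_edge_subset[OF assms(1)])
  moreover have "(`) (f(w := u)) ` (\<lambda>a. {a, w}) ` A = (\<lambda>a. {a, u}) ` f ` A"
    unfolding image_image using assms(2,3) by (intro image_cong) auto
  ultimately show ?thesis
    unfolding map_sgraph_def add_vertex_def sgraph.simps image_Un by simp
qed

section \<open>Monochromatic copies as embeddings\<close>

definition mono_embedding ::
  "'a coloring \<Rightarrow> bool \<Rightarrow> ('b \<Rightarrow> 'a) \<Rightarrow> 'b sgraph \<Rightarrow> 'a sgraph \<Rightarrow> bool" where
  "mono_embedding c b g H F \<longleftrightarrow>
     inj_on g (verts H) \<and> g ` verts H \<subseteq> verts F \<and>
     (\<forall>e \<in> edges H. g ` e \<in> edges F \<and> c (g ` e) = b)"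

lemma has_mono_copyE:
  assumes "has_mono_copy c F H"
  obtains b g where "mono_embedding c b g H F"
proof -
  obtain K f b where subgraph_K: "subgraph K F" and mono: "\<forall>e \<in> edges K. c e = b"
    and bij: "bij_betw f (verts K) (verts H)" and edges_H: "(`) f ` edges K = edges H"
    using assms by (auto simp: has_mono_copy_def isomorphic_def monochromatic_def)
  let ?g = "inv_into (verts K) f"
  have "(`) ?g ` edges H = edges (map_sgraph ?g (map_sgraph f K))"
    by (simp add: map_sgraph_def edges_H)
  also have "\<dots> = edges K"
    using subgraph_K bij map_sgraph_inv_into[of K f] by (simp add: subgraph_def bij_betw_def)
  finally have "(`) ?g ` edges H = edges K" .
  moreover have "bij_betw ?g (verts H) (verts K)"
    using bij by (rule bij_betw_inv_into)
  ultimately have "mono_embedding c b ?g H F"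
    using subgraph_K mono by (auto simp: mono_embedding_def bij_betw_def subgraph_def)
  then show thesis
    by (rule that)
qed

lemma has_mono_copyI:
  assumes "simple_graph F" "simple_graph H" "mono_embedding c b g H F"
  shows "has_mono_copy c F H"
proof -
  have inj_g: "inj_on g (verts H)"
    using assms(3) by (simp add: mono_embedding_def)
  have "subgraph (map_sgraph g H) F"
    using assms simple_graph_map[OF assms(2) inj_g]
    by (auto simp: subgraph_def mono_embedding_def map_sgraph_def)
  moreover have "monochromatic c (map_sgraph g H)"
    using assms(3) by (auto simp: monochromatic_def mono_embedding_def map_sgraph_def)
  ultimately show ?thesis
    using isomorphic_map[OF assms(2) inj_g] unfolding has_mono_copy_def by blast
qed

lemma mono_embedding_delete_verts:
  assumes "mono_embedding c b g H F" "simple_graph H" "g ` verts H \<inter> S = {}"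
  shows "mono_embedding c b g H (delete_verts F S)"
proof -
  have "g ` e \<subseteq> verts F - S" if "e \<in> edges H" for e
    using assms(1,3) simple_graph_edge_subset[OF assms(2) that]
    by (fastforce simp: mono_embedding_def)
  then show ?thesis
    using assms(1,3) by (auto simp: mono_embedding_def delete_verts_simps)
qed

lemma mono_embedding_cong:
  "(\<And>e. e \<in> edges F \<Longrightarrow> c e = c' e) \<Longrightarrow> mono_embedding c b g H F \<longleftrightarrow> mono_embedding c' b g H F"
  by (auto simp: mono_embedding_def)

lemma mono_embedding_image_neighbors:
  "mono_embedding c b g H F \<Longrightarrow> g ` neighbors H x \<subseteq> {u \<in> neighbors F (g x). c {u, g x} = b}"
  by (force simp: mono_embedding_def neighbors_def)

lemma mono_embedding_card_image_neighbors:
  assumes "mono_embedding c b g H F" "simple_graph H"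
  shows "card (g ` neighbors H x) = vdegree H x"
  using assms neighbors_subset_verts[OF assms(2), of x]
  unfolding mono_embedding_def vdegree_def by (meson card_image inj_on_subset)

lemma mono_embedding_vdegree_le:
  assumes "mono_embedding c b g H F" "simple_graph H" "simple_graph F"
  shows "vdegree H x \<le> card {u \<in> neighbors F (g x). c {u, g x} = b}"
proof -
  have "card (g ` neighbors H x) \<le> card {u \<in> neighbors F (g x). c {u, g x} = b}"
    using mono_embedding_image_neighbors[OF assms(1)] finite_neighbors[OF assms(3)]
    by (intro card_mono) simp_all
  then show ?thesis
    by (simp add: mono_embedding_card_image_neighbors[OF assms(1,2)])
qed

lemma mono_embedding_image_neighbors_eq:
  assumes "mono_embedding c b g H F" "simple_graph H" "simple_graph F"
    and "vdegree F (g x) \<le> vdegree H x"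
  shows "g ` neighbors H x = neighbors F (g x)"
proof (rule card_seteq)
  show "finite (neighbors F (g x))"
    using assms(3) by (rule finite_neighbors)
  show "g ` neighbors H x \<subseteq> neighbors F (g x)"
    using mono_embedding_image_neighbors[OF assms(1)] by blast
  show "card (neighbors F (g x)) \<le> card (g ` neighbors H x)"
    using mono_embedding_card_image_neighbors[OF assms(1,2)] assms(4) by (simp add: vdegree_def)
qed

lemma has_mono_copy_subgraph: "subgraph F' F \<Longrightarrow> has_mono_copy c F' H \<Longrightarrow> has_mono_copy c F H"
  unfolding has_mono_copy_def by (meson subgraph_trans)

lemma has_mono_copy_Not: "has_mono_copy (\<lambda>e. \<not> c e) F H \<longleftrightarrow> has_mono_copy c F H"
proof -
  have "monochromatic (\<lambda>e. \<not> c e) K \<longleftrightarrow> monochromatic c K" for K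
    unfolding monochromatic_def by metis
  then show ?thesis
    by (simp add: has_mono_copy_def)
qed

lemma has_mono_copy_map:
  assumes "simple_graph G" "simple_graph H" "inj_on f (verts G)"
    and "has_mono_copy (\<lambda>e. c (f ` e)) G H"
  shows "has_mono_copy c (map_sgraph f G) H"
proof -
  obtain b g where embedding: "mono_embedding (\<lambda>e. c (f ` e)) b g H G"
    using assms(4) by (rule has_mono_copyE)
  have "inj_on (f \<circ> g) (verts H)"
    using embedding assms(3) by (auto simp: mono_embedding_def intro: comp_inj_on inj_on_subset)
  moreover have "(f \<circ> g) ` e = f ` g ` e" for e
    by (simp add: image_comp)
  ultimately have "mono_embedding c b (f \<circ> g) H (map_sgraph f G)"
    using embedding by (auto simp: mono_embedding_def map_sgraph_def)
  then show ?thesis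
    using has_mono_copyI simple_graph_map assms(1-3) by blast
qed

lemma arrowsE:
  assumes "arrows F H"
  obtains b g where "mono_embedding c b g H F"
  using assms has_mono_copyE unfolding arrows_def by blast

lemma arrows_subgraph: "subgraph F' F \<Longrightarrow> arrows F' H \<Longrightarrow> arrows F H"
  unfolding arrows_def using has_mono_copy_subgraph by blast

section \<open>Critical vertices and minimal graphs\<close>

definition critical_vertex :: "'a sgraph \<Rightarrow> 'b sgraph \<Rightarrow> 'a \<Rightarrow> bool" where
  "critical_vertex F H w \<longleftrightarrow>
     simple_graph F \<and> arrows F H \<and> \<not> arrows (delete_verts F {w}) H"

lemma ex_ramsey_minimal_subgraph:
  assumes "simple_graph F" "arrows F H"
  shows "\<exists>M. subgraph M F \<and> M \<in> ramsey_minimal_graphs H"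
  using assms
proof (induction "card (verts F <+> edges F)" arbitrary: F rule: less_induct)
  case less
  show ?case
  proof (cases "F \<in> ramsey_minimal_graphs H")
    case True
    then show ?thesis
      using less.prems subgraph_refl by blast
  next
    case False
    then obtain F' where "subgraph F' F" "F' \<noteq> F" "arrows F' H"
      using less.prems by (auto simp: ramsey_minimal_graphs_def)
    have "\<not> (verts F \<subseteq> verts F' \<and> edges F \<subseteq> edges F')"
      using \<open>subgraph F' F\<close> \<open>F' \<noteq> F\<close> subgraph_antisym[of F' F] by (auto simp: subgraph_def)
    then have "verts F' <+> edges F' \<subset> verts F <+> edges F"
      using \<open>subgraph F' F\<close> unfolding subgraph_def by blast
    then have "card (verts F' <+> edges F') < card (verts F <+> edges F)"
      using less.prems(1)
      by (intro psubset_card_mono)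
        (auto simp: simple_graph_finite_verts simple_graph_finite_edges)
    then show ?thesis
      using less.hyps \<open>subgraph F' F\<close> \<open>arrows F' H\<close> subgraph_trans by (meson subgraph_def)
  qed
qed

lemma ramsey_minimal_critical_vertex:
  assumes "M \<in> ramsey_minimal_graphs H" "w \<in> verts M"
  shows "critical_vertex M H w"
proof -
  have "delete_verts M {w} \<noteq> M"
    using assms(2) by (metis Diff_iff delete_verts_simps(1) singletonI)
  then show ?thesis
    using assms(1) subgraph_delete_verts[of M "{w}"]
    by (auto simp: ramsey_minimal_graphs_def critical_vertex_def)
qed

lemma critical_vertex_vdegree_ge:
  assumes simple_H: "simple_graph H" and degrees_H: "\<And>x. x \<in> verts H \<Longrightarrow> d \<le> vdegree H x"
    and critical: "critical_vertex F H w"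
  shows "2 * d - 1 \<le> vdegree F w"
proof (rule ccontr)
  assume small_degree: "\<not> 2 * d - 1 \<le> vdegree F w"
  have simple_F: "simple_graph F" and arrows_F: "arrows F H"
    using critical by (simp_all add: critical_vertex_def)
  let ?N = "neighbors F w"
  have "card ?N < 2 * d - 1"
    using small_degree by (simp add: vdegree_def)
  then obtain A where "A \<subseteq> ?N" and halves: "card A < d" "card (?N - A) < d"
    using ex_subset_and_complement_card_less[OF finite_neighbors[OF simple_F]] by blast
  obtain c where no_copy: "\<not> has_mono_copy c (delete_verts F {w}) H"
    using critical by (auto simp: critical_vertex_def arrows_def)
  define c' where "c' e \<longleftrightarrow> (if w \<in> e then e \<in> (\<lambda>u. {u, w}) ` A else c e)" for e
  obtain b g where embedding: "mono_embedding c' b g H F"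
    using arrows_F by (rule arrowsE)
  have "w \<notin> g ` verts H"
  proof
    assume "w \<in> g ` verts H"
    then obtain x where "x \<in> verts H" "g x = w"
      by blast
    then have "d \<le> card {u \<in> ?N. c' {u, w} = b}"
      using degrees_H mono_embedding_vdegree_le[OF embedding simple_H simple_F, of x] by force
    also have "{u \<in> ?N. c' {u, w} = b} = (if b then A else ?N - A)"
      using \<open>A \<subseteq> ?N\<close> by (auto simp: c'_def doubleton_eq_iff)
    finally show False
      using halves by (auto split: if_splits)
  qed
  then have "mono_embedding c' b g H (delete_verts F {w})"
    by (intro mono_embedding_delete_verts[OF embedding simple_H]) simp
  also have "?this \<longleftrightarrow> mono_embedding c b g H (delete_verts F {w})"
    by (rule mono_embedding_cong) (simp add: c'_def delete_verts_simps subset_Diff_insert)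
  finally show False
    using no_copy has_mono_copyI[OF simple_graph_delete_verts[OF simple_F] simple_H] by blast
qed

lemma ramsey_s_ge:
  fixes F :: "nat sgraph"
  assumes "simple_graph H" "verts H \<noteq> {}" "\<And>x. x \<in> verts H \<Longrightarrow> d \<le> vdegree H x"
    and "simple_graph F" "arrows F H"
  shows "2 * d - 1 \<le> ramsey_s H"
proof -
  have "2 * d - 1 \<le> min_degree M" if minimal: "M \<in> ramsey_minimal_graphs H" for M
  proof -
    have "simple_graph M" "arrows M H"
      using minimal by (simp_all add: ramsey_minimal_graphs_def)
    obtain b g where "mono_embedding (\<lambda>_. True) b g H M"
      using \<open>arrows M H\<close> by (rule arrowsE)
    then have "verts M \<noteq> {}"
      using assms(2) by (auto simp: mono_embedding_def)
    moreover have "finite (verts M)"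
      using \<open>simple_graph M\<close> by (rule simple_graph_finite_verts)
    moreover have "2 * d - 1 \<le> vdegree M w" if "w \<in> verts M" for w
      using assms(1,3) ramsey_minimal_critical_vertex[OF minimal that]
      by (rule critical_vertex_vdegree_ge)
    ultimately show ?thesis
      by (simp add: min_degree_def)
  qed
  moreover have "ramsey_minimal_graphs H \<noteq> {}"
    using ex_ramsey_minimal_subgraph[OF assms(4,5)] by blast
  ultimately show ?thesis
    unfolding ramsey_s_def by (intro cInf_greatest) auto
qed

lemma ramsey_s_le_vdegree:
  fixes F :: "nat sgraph"
  assumes "critical_vertex F H w"
  shows "ramsey_s H \<le> vdegree F w"
proof -
  obtain M where sub: "subgraph M F" and minimal: "M \<in> ramsey_minimal_graphs H"
    using assms ex_ramsey_minimal_subgraph[of F H] by (auto simp: critical_vertex_def)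
  have "w \<in> verts M"
  proof (rule ccontr)
    assume "w \<notin> verts M"
    then have "subgraph M (delete_verts F {w})"
      using subgraph_delete_vertsI[OF sub] by simp
    moreover have "arrows M H"
      using minimal by (simp add: ramsey_minimal_graphs_def)
    ultimately have "arrows (delete_verts F {w}) H"
      by (rule arrows_subgraph)
    then show False
      using assms by (simp add: critical_vertex_def)
  qed
  have "ramsey_s H \<le> min_degree M"
    unfolding ramsey_s_def using minimal by (intro cInf_lower) auto
  also have "\<dots> \<le> vdegree M w"
    using sub \<open>w \<in> verts M\<close> by (simp add: min_degree_def subgraph_def simple_graph_finite_verts)
  also have "\<dots> \<le> vdegree F w"
    using sub by (rule subgraph_vdegree_le)
  finally show ?thesis .
qed

section \<open>Gadgets\<close>

definition forcing_embedding ::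
  "('c \<Rightarrow> 'a) \<Rightarrow> 'c coloring \<Rightarrow> 'c sgraph \<Rightarrow> 'a sgraph \<Rightarrow> 'b sgraph \<Rightarrow> bool" where
  "forcing_embedding f \<psi> G F H \<longleftrightarrow> inj_on f (verts G) \<and> subgraph (map_sgraph f G) F \<and>
     (\<forall>c. \<not> has_mono_copy c F H \<longrightarrow>
        (\<forall>e \<in> edges G. c (f ` e) = \<psi> e) \<or> (\<forall>e \<in> edges G. c (f ` e) = (\<not> \<psi> e)))"

lemma BEL_gadgets_forcing_embedding:
  fixes G :: "'c sgraph"
  assumes gadgets: "has_BEL_gadgets H" and simple_H: "simple_graph H" and simple_G: "simple_graph G"
    and no_copy: "\<not> has_mono_copy \<psi> G H"
  obtains F :: "nat sgraph" and f where "simple_graph F" "\<not> arrows F H" "forcing_embedding f \<psi> G F H"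
proof -
  obtain f :: "'c \<Rightarrow> nat" where inj_f: "inj_on f (verts G)"
    using finite_imp_inj_to_nat_seg[OF simple_graph_finite_verts[OF simple_G]] by blast
  let ?h = "inv_into (verts G) f" and ?G = "map_sgraph f G"
  define \<psi>' where "\<psi>' e = \<psi> (?h ` e)" for e
  have \<psi>'_image: "\<psi>' (f ` e) = \<psi> e" if "e \<in> edges G" for e
    using inv_into_image_cancel[OF inj_f simple_graph_edge_subset[OF simple_G that]]
    by (simp add: \<psi>'_def)
  have simple_image: "simple_graph ?G"
    using simple_G inj_f by (rule simple_graph_map)
  have "inj_on ?h (verts ?G)"
    by (simp add: map_sgraph_def inj_on_inv_into)
  then have "has_mono_copy \<psi> (map_sgraph ?h ?G) H" if "has_mono_copy \<psi>' ?G H"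
    using that unfolding \<psi>'_def by (rule has_mono_copy_map[OF simple_image simple_H])
  then have "\<not> has_mono_copy \<psi>' ?G H"
    using no_copy by (simp add: map_sgraph_inv_into[OF simple_G inj_f]) blast
  then obtain F where "simple_graph F" "\<not> arrows F H" and induced: "induced_subgraph ?G F"
    and rigid: "\<And>c. \<not> has_mono_copy c F H \<Longrightarrow>
      (\<forall>e \<in> edges ?G. c e = \<psi>' e) \<or> (\<forall>e \<in> edges ?G. c e = (\<not> \<psi>' e))"
    using gadgets simple_image unfolding has_BEL_gadgets_def by blast
  have "(\<forall>e \<in> edges G. c (f ` e) = \<psi> e) \<or> (\<forall>e \<in> edges G. c (f ` e) = (\<not> \<psi> e))"
    if "\<not> has_mono_copy c F H" for c
    using rigid[OF that] by (simp add: map_sgraph_def \<psi>'_image)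
  moreover have "subgraph ?G F"
    using induced by (simp only: induced_subgraph_def)
  ultimately have "forcing_embedding f \<psi> G F H"
    using inj_f by (simp add: forcing_embedding_def)
  with \<open>simple_graph F\<close> \<open>\<not> arrows F H\<close> show thesis
    by (rule that)
qed

lemma has_mono_copy_map_add_vertex:
  assumes simple_G: "simple_graph G" and simple_H: "simple_graph H"
    and w_notin_G: "w \<notin> verts G" and A_in_G: "A \<subseteq> verts G" and inj_f: "inj_on f (verts G)"
    and sub: "subgraph (map_sgraph f G) F" and u_notin_F: "u \<notin> verts F"
    and copy: "has_mono_copy (\<lambda>e. c (f(w := u) ` e)) (add_vertex w A G) H"
  shows "has_mono_copy c (add_vertex u (f ` A) F) H"
proof -
  have "inj_on (f(w := u)) (verts (add_vertex w A G))"
    using w_notin_G inj_f sub u_notin_F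
    by (auto simp: add_vertex_def map_sgraph_def subgraph_def inj_on_def)
  then have "has_mono_copy c (map_sgraph (f(w := u)) (add_vertex w A G)) H"
    using has_mono_copy_map[OF simple_graph_add_vertex[OF simple_G w_notin_G A_in_G] simple_H _ copy]
    by blast
  then have "has_mono_copy c (add_vertex u (f ` A) (map_sgraph f G)) H"
    by (simp only: map_sgraph_add_vertex[OF simple_G w_notin_G A_in_G])
  moreover have "f ` A \<subseteq> verts (map_sgraph f G)"
    using A_in_G by (auto simp: map_sgraph_def)
  ultimately show ?thesis
    using subgraph_add_vertex[OF sub u_notin_F] has_mono_copy_subgraph by blast
qed

lemma arrows_add_vertex:
  assumes simple_G: "simple_graph G" and simple_H: "simple_graph H" and simple_F: "simple_graph F"
    and forcing: "forcing_embedding f \<psi> G F H"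
    and w_notin_G: "w \<notin> verts G" and A_in_G: "A \<subseteq> verts G" and u_notin_F: "u \<notin> verts F"
    and extension: "\<And>c. (\<forall>e \<in> edges G. c e = \<psi> e) \<Longrightarrow> has_mono_copy c (add_vertex w A G) H"
  shows "arrows (add_vertex u (f ` A) F) H"
  unfolding arrows_def
proof
  fix c
  have inj_f: "inj_on f (verts G)" and sub: "subgraph (map_sgraph f G) F"
    using forcing by (simp_all add: forcing_embedding_def)
  show "has_mono_copy c (add_vertex u (f ` A) F) H"
  proof (cases "has_mono_copy c F H")
    case True
    have "f ` A \<subseteq> verts F"
      using A_in_G sub by (auto simp: map_sgraph_def subgraph_def)
    with simple_F u_notin_F have "subgraph F (add_vertex u (f ` A) F)"
      by (rule subgraph_add_vertex_self)
    then show ?thesis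
      using True by (rule has_mono_copy_subgraph)
  next
    case False
    let ?c = "\<lambda>e. c (f(w := u) ` e)"
    have "f(w := u) ` e = f ` e" if "e \<in> edges G" for e
      using simple_graph_edge_subset[OF simple_G that] w_notin_G
      by (auto simp only: fun_upd_image split: if_splits)
    then have "(\<forall>e \<in> edges G. ?c e = \<psi> e) \<or> (\<forall>e \<in> edges G. (\<not> ?c e) = \<psi> e)"
      using forcing False unfolding forcing_embedding_def by auto
    then have "has_mono_copy ?c (add_vertex w A G) H"
      using extension[of ?c] extension[of "\<lambda>e. \<not> ?c e"] by (auto simp: has_mono_copy_Not)
    then show ?thesis
      by (rule has_mono_copy_map_add_vertex[OF simple_G simple_H w_notin_G A_in_G inj_f sub u_notin_F])
  qed
qed

lemma BEL_gadgets_critical_vertex: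
  fixes G :: "'c sgraph"
  assumes gadgets: "has_BEL_gadgets H" and simple_H: "simple_graph H" and simple_G: "simple_graph G"
    and no_copy: "\<not> has_mono_copy \<psi> G H" and w_notin_G: "w \<notin> verts G" and A_in_G: "A \<subseteq> verts G"
    and extension: "\<And>c. (\<forall>e \<in> edges G. c e = \<psi> e) \<Longrightarrow> has_mono_copy c (add_vertex w A G) H"
  obtains F :: "nat sgraph" and u where "critical_vertex F H u" "vdegree F u = card A"
proof -
  obtain F :: "nat sgraph" and f where simple_F: "simple_graph F" and not_arrows: "\<not> arrows F H"
    and forcing: "forcing_embedding f \<psi> G F H"
    using gadgets simple_H simple_G no_copy by (rule BEL_gadgets_forcing_embedding)
  then have inj_f: "inj_on f (verts G)" and "f ` verts G \<subseteq> verts F"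
    by (auto simp: forcing_embedding_def map_sgraph_def subgraph_def)
  then have image_A: "f ` A \<subseteq> verts F"
    using A_in_G by blast
  obtain u where u_notin_F: "u \<notin> verts F"
    using ex_new_if_finite[OF infinite_UNIV_nat simple_graph_finite_verts[OF simple_F]] by blast
  let ?F = "add_vertex u (f ` A) F"
  have "arrows ?F H"
    using simple_G simple_H simple_F forcing w_notin_G A_in_G u_notin_F extension
    by (rule arrows_add_vertex)
  then have "critical_vertex ?F H u"
    using simple_graph_add_vertex[OF simple_F u_notin_F image_A] not_arrows
    by (simp add: critical_vertex_def delete_add_vertex[OF simple_F u_notin_F])
  moreover have "vdegree ?F u = card A"
    using vdegree_add_vertex[OF simple_F u_notin_F image_A] card_image inj_on_subset[OF inj_f A_in_G]
    by metis
  ultimately show thesis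
    by (rule that)
qed

section \<open>The host graph\<close>

datatype 'a host_vertex = Terminal nat | Part "nat set \<times> bool" 'a

locale rooted_regular_graph =
  fixes H :: "'a sgraph" and v :: 'a and d :: nat
  assumes d_ge_1: "d \<ge> 1" and simple_H: "simple_graph H" and regular_H: "regular_graph d H"
    and root_in_H: "v \<in> verts H" and independent_N: "independent_set H (neighbors H v)"
    and connected_outer: "connected_graph (delete_verts H ({v} \<union> neighbors H v))"
begin

abbreviation N :: "'a set" where
  "N \<equiv> neighbors H v"

abbreviation terminals :: "'a host_vertex set" where
  "terminals \<equiv> Terminal ` {..<2 * d - 1}"

abbreviation apex :: "'a host_vertex" where
  "apex \<equiv> Terminal (2 * d - 1)"

definition outer :: "'a set" where
  "outer = verts H - ({v} \<union> N)"

definition slots :: "(nat set \<times> bool) set" where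
  "slots = {S. S \<subseteq> {..<2 * d - 1} \<and> card S = d} \<times> UNIV"

definition labelling :: "nat set \<Rightarrow> 'a \<Rightarrow> nat" where
  "labelling S = (SOME f. bij_betw f N S)"

definition place :: "nat set \<times> bool \<Rightarrow> 'a \<Rightarrow> 'a host_vertex" where
  "place i x = (if x \<in> N then Terminal (labelling (fst i) x) else Part i x)"

definition block :: "nat set \<times> bool \<Rightarrow> 'a host_vertex set" where
  "block i = place i ` (verts H - {v})"

text \<open>For every \<open>d\<close>-subset \<open>S\<close> of \<open>2 d - 1\<close> independent vertices and each of the two colors, the
  host graph has a private copy of \<open>H - v - N(v)\<close> in that color, attached to \<open>S\<close> in the same color
  as it is attached to \<open>N(v)\<close> in \<open>H\<close>. As \<open>N(v)\<close> is independent, every edge of \<open>H - v\<close> has an end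
  in \<open>H - v - N(v)\<close>.\<close>

definition host :: "'a host_vertex sgraph" where
  "host = \<lparr>verts = terminals \<union> (\<Union>i\<in>slots. Part i ` outer),
           edges = {{place i x, Part i y} | i x y. i \<in> slots \<and> y \<in> outer \<and> x \<in> neighbors H y}\<rparr>"

definition host_coloring :: "'a host_vertex coloring" where
  "host_coloring e \<longleftrightarrow> (\<exists>i y. Part i y \<in> e \<and> snd i)"

lemma vdegree_H: "x \<in> verts H \<Longrightarrow> vdegree H x = d"
  using regular_H by (simp add: regular_graph_def)

lemma neighbors_H_nonempty: "x \<in> verts H \<Longrightarrow> neighbors H x \<noteq> {}"
  using vdegree_H d_ge_1 by (force simp: vdegree_def)

lemma card_N: "card N = d"
  using vdegree_H[OF root_in_H] by (simp add: vdegree_def)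

lemma neighbor_of_outer:
  assumes "y \<in> outer" "x \<in> neighbors H y"
  shows "x \<in> verts H - {v}"
  using assms neighbors_subset_verts[OF simple_H, of y]
  by (auto simp: outer_def in_neighbors_commute[of v])

lemma edge_avoiding_rootE:
  assumes "e \<in> edges H" "v \<notin> e"
  obtains x y where "e = {x, y}" "y \<in> outer" "x \<in> neighbors H y"
proof -
  obtain y where "y \<in> e" "y \<in> outer"
  proof -
    obtain x y where "e = {x, y}" "x \<in> verts H" "y \<in> verts H"
      using simple_H assms(1) by (rule simple_graph_edgeE)
    then show thesis
      using that independent_N assms by (auto simp: independent_set_def outer_def)
  qed
  show thesis
    using incident_edgeE[OF simple_H assms(1) \<open>y \<in> e\<close>] \<open>y \<in> outer\<close> that by metis
qed

lemma slotsD: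
  assumes "i \<in> slots"
  shows "fst i \<subseteq> {..<2 * d - 1}" "card (fst i) = d" "finite (fst i)"
  using assms finite_subset[OF _ finite_lessThan] by (auto simp: slots_def)

lemma finite_slots: "finite slots"
  by (rule finite_subset[of _ "Pow {..<2 * d - 1} \<times> UNIV"]) (auto simp: slots_def)

lemma bij_betw_labelling: "i \<in> slots \<Longrightarrow> bij_betw (labelling (fst i)) N (fst i)"
  unfolding labelling_def
  by (rule someI_ex[OF finite_same_card_bij])
    (auto simp: finite_neighbors simple_H card_N slotsD)

lemma place_outer: "y \<in> outer \<Longrightarrow> place i y = Part i y"
  by (simp add: place_def outer_def)

lemma place_N: "x \<in> N \<Longrightarrow> place i x = Terminal (labelling (fst i) x)"
  by (simp add: place_def)

lemma inj_on_place: "i \<in> slots \<Longrightarrow> inj_on (place i) (verts H)"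
  using bij_betw_labelling by (auto simp: place_def inj_on_def bij_betw_def)

lemma block_eq:
  assumes "i \<in> slots"
  shows "block i = Terminal ` fst i \<union> Part i ` outer"
proof -
  have "verts H - {v} = N \<union> outer"
    using neighbors_subset_verts[OF simple_H, of v] not_in_own_neighbors[OF simple_H, of v]
    by (auto simp: outer_def)
  moreover have "place i ` N = Terminal ` fst i"
    using bij_betw_imp_surj_on[OF bij_betw_labelling[OF assms]]
    by (metis (no_types, lifting) image_cong image_image place_N)
  moreover have "place i ` outer = Part i ` outer"
    by (intro image_cong) (simp_all add: place_outer)
  ultimately show ?thesis
    by (simp add: block_def image_Un)
qed

lemma finite_block: "finite (block i)"
  using simple_graph_finite_verts[OF simple_H] by (simp add: block_def)

lemma card_block: "i \<in> slots \<Longrightarrow> card (block i) = card (verts H) - 1"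
  unfolding block_def using root_in_H inj_on_subset[OF inj_on_place]
  by (subst card_image) auto

lemma block_subset_host: "i \<in> slots \<Longrightarrow> block i \<subseteq> verts host"
  using slotsD[of i] by (auto simp: block_eq host_def)

lemma host_edgeI:
  "i \<in> slots \<Longrightarrow> y \<in> outer \<Longrightarrow> x \<in> neighbors H y \<Longrightarrow> {place i x, Part i y} \<in> edges host"
  unfolding host_def sgraph.simps by blast

lemma host_edgeE:
  assumes "e \<in> edges host"
  obtains i x y where "e = {place i x, Part i y}" "i \<in> slots" "y \<in> outer" "x \<in> neighbors H y"
  using assms by (auto simp: host_def)

lemma simple_host: "simple_graph host"
  unfolding simple_graph_def
proof (intro conjI subsetI)
  show "finite (verts host)"
    using simple_graph_finite_verts[OF simple_H] finite_slots by (simp add: host_def outer_def)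
next
  fix e assume "e \<in> edges host"
  then obtain i x y where edge: "e = {place i x, Part i y}"
    and "i \<in> slots" "y \<in> outer" "x \<in> neighbors H y"
    by (rule host_edgeE)
  have "place i x \<in> verts host"
    using neighbor_of_outer[OF \<open>y \<in> outer\<close> \<open>x \<in> neighbors H y\<close>] block_subset_host[OF \<open>i \<in> slots\<close>]
    by (auto simp: block_def)
  moreover have "Part i y \<in> verts host"
    using \<open>i \<in> slots\<close> \<open>y \<in> outer\<close> by (auto simp: host_def)
  moreover have "place i x \<noteq> Part i y"
    using \<open>x \<in> neighbors H y\<close> not_in_own_neighbors[OF simple_H]
    by (auto simp: place_def split: if_splits)
  ultimately show "e \<in> {{u, v} |u v. u \<in> verts host \<and> v \<in> verts host \<and> u \<noteq> v}"
    using edge by blast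
qed

lemma host_coloring_edge: "host_coloring {place i x, Part i y} = snd i"
  by (cases i) (auto simp: host_coloring_def place_def)

lemma neighbors_host_Part:
  assumes "i \<in> slots" "y \<in> outer"
  shows "neighbors host (Part i y) = place i ` neighbors H y"
proof
  show "neighbors host (Part i y) \<subseteq> place i ` neighbors H y"
  proof
    fix u assume "u \<in> neighbors host (Part i y)"
    then obtain j x z where "{u, Part i y} = {place j x, Part j z}"
      and "z \<in> outer" "x \<in> neighbors H z"
      by (auto simp: neighbors_def elim: host_edgeE)
    then consider (outer_end) "u = place j x" "Part i y = Part j z"
      | (other_end) "u = Part j z" "Part i y = place j x"
      by (auto simp: doubleton_eq_iff)
    then show "u \<in> place i ` neighbors H y"
    proof cases
      case outer_end
      then show ?thesis
        using \<open>x \<in> neighbors H z\<close> by simp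
    next
      case other_end
      then have "j = i" "x = y"
        by (auto simp: place_def split: if_splits)
      then show ?thesis
        using other_end \<open>x \<in> neighbors H z\<close> \<open>z \<in> outer\<close>
        by (metis imageI in_neighbors_commute place_outer)
    qed
  qed
  show "place i ` neighbors H y \<subseteq> neighbors host (Part i y)"
    using host_edgeI[OF assms] by (auto simp: neighbors_def[of host])
qed

lemma neighbors_host_Terminal:
  assumes "u \<in> neighbors host (Terminal k)"
  obtains i y where "u = Part i y" "i \<in> slots" "k \<in> fst i"
proof -
  obtain i x y where edge: "{u, Terminal k} = {place i x, Part i y}"
    and "i \<in> slots" "y \<in> outer" "x \<in> neighbors H y"
    using assms by (auto simp: neighbors_def elim: host_edgeE)
  from edge have "u = Part i y" "Terminal k = place i x"
    by (auto simp: doubleton_eq_iff)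
  moreover from this have "Terminal k \<in> block i"
    using neighbor_of_outer[OF \<open>y \<in> outer\<close> \<open>x \<in> neighbors H y\<close>]
    by (simp add: block_def)
  ultimately show thesis
    using that \<open>i \<in> slots\<close> by (auto simp: block_eq)
qed

lemma N_has_outer_neighbor:
  assumes "d \<ge> 2" "x \<in> N"
  obtains y where "y \<in> outer" "x \<in> neighbors H y"
proof -
  have "card (neighbors H x) = d"
    using assms(2) neighbors_subset_verts[OF simple_H, of v] vdegree_H by (auto simp: vdegree_def)
  then have "\<not> neighbors H x \<subseteq> {v}"
    using assms(1) card_mono[of "{v}" "neighbors H x"] by auto
  then obtain y where "y \<in> neighbors H x" "y \<noteq> v"
    by blast
  then have "y \<notin> N"
    using independent_N assms(2) by (auto simp: independent_set_def neighbors_def)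
  then show thesis
    using that \<open>y \<in> neighbors H x\<close> \<open>y \<noteq> v\<close>
      neighbors_subset_verts[OF simple_H, of x] in_neighbors_commute[of x]
    by (auto simp: outer_def)
qed

lemma distinct_slots_imp_d_ge_2:
  assumes "i \<in> slots" "j \<in> slots" "fst i \<noteq> fst j"
  shows "d \<ge> 2"
proof (rule ccontr)
  assume "\<not> d \<ge> 2"
  then have "d = 1"
    using d_ge_1 by simp
  then have "fst l = {..<1}" if "l \<in> slots" for l
    using slotsD[OF that] by (intro card_subset_eq) auto
  then show False
    using assms by simp
qed

context
  fixes b g
  assumes embedding: "mono_embedding host_coloring b g H host"
begin

text \<open>A copy of a vertex outside \<open>N(v)\<close> has degree exactly \<open>d\<close> in the host, so an embedding that
  uses it must use all its neighbors.\<close>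

lemma image_closed_at_Part:
  assumes "Part i y \<in> g ` verts H"
  shows "i \<in> slots" "y \<in> outer" "snd i = b" "place i ` neighbors H y \<subseteq> g ` verts H"
proof -
  obtain x where "x \<in> verts H" and g_x: "g x = Part i y"
    using assms by force
  show slot: "i \<in> slots" and y_outer: "y \<in> outer"
    using assms embedding by (auto simp: mono_embedding_def host_def)
  have "vdegree host (g x) \<le> vdegree H y"
    using g_x card_image_le[OF finite_neighbors[OF simple_H]]
    by (simp add: vdegree_def neighbors_host_Part[OF slot y_outer])
  then have image_neighbors: "g ` neighbors H x = place i ` neighbors H y"
    using mono_embedding_image_neighbors_eq[OF embedding simple_H simple_host, of x]
      \<open>x \<in> verts H\<close> g_x y_outer
    by (simp add: vdegree_H outer_def neighbors_host_Part[OF slot y_outer])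
  then show "place i ` neighbors H y \<subseteq> g ` verts H"
    using neighbors_subset_verts[OF simple_H, of x] by blast
  obtain z where "place i z \<in> g ` neighbors H x"
    using image_neighbors neighbors_H_nonempty[OF \<open>x \<in> verts H\<close>] by blast
  then have "host_coloring {place i z, Part i y} = b"
    using mono_embedding_image_neighbors[OF embedding, of x] g_x by auto
  then show "snd i = b"
    by (simp add: host_coloring_edge)
qed

lemma image_contains_part:
  assumes "Part i y \<in> g ` verts H"
  shows "Part i ` outer \<subseteq> g ` verts H"
proof -
  let ?O = "delete_verts H ({v} \<union> N)"
  have verts_O: "verts ?O = outer"
    by (simp add: delete_verts_simps outer_def)
  have "verts ?O \<subseteq> {z. Part i z \<in> g ` verts H}"
  proof (rule connected_graph_verts_subset[OF connected_outer])
    show "y \<in> verts ?O"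
      using image_closed_at_Part(2)[OF assms] verts_O by simp
    show "y \<in> {z. Part i z \<in> g ` verts H}"
      using assms by simp
    fix x z assume x_in: "x \<in> {z. Part i z \<in> g ` verts H}" and "{x, z} \<in> edges ?O"
    then have "z \<in> neighbors H x" "z \<in> outer"
      by (auto simp: delete_verts_simps outer_def neighbors_def insert_commute)
    then have "place i z \<in> g ` verts H"
      using image_closed_at_Part(4)[of i x] x_in by blast
    then show "z \<in> {z. Part i z \<in> g ` verts H}"
      by (simp add: place_outer \<open>z \<in> outer\<close>)
  qed
  then show ?thesis
    using verts_O by blast
qed

lemma image_contains_block:
  assumes "Part i y \<in> g ` verts H" "d \<ge> 2"
  shows "block i \<subseteq> g ` verts H"
proof
  fix u assume "u \<in> block i"
  then obtain x where "x \<in> verts H - {v}" and u_eq: "u = place i x"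
    by (auto simp: block_def)
  show "u \<in> g ` verts H"
  proof (cases "x \<in> N")
    case True
    then obtain z where "z \<in> outer" "x \<in> neighbors H z"
      using N_has_outer_neighbor[OF assms(2)] by blast
    then show ?thesis
      using image_contains_part[OF assms(1)] image_closed_at_Part(4)[of i z] u_eq
      by blast
  next
    case False
    then show ?thesis
      using \<open>x \<in> verts H - {v}\<close> u_eq image_contains_part[OF assms(1)]
      by (auto simp: outer_def place_def)
  qed
qed

lemma card_image_verts_H: "card (g ` verts H) = card (verts H)"
  using embedding by (simp add: mono_embedding_def card_image)

lemma image_meets_unique_slot:
  assumes meets_i: "Part i y \<in> g ` verts H" and meets_j: "Part j z \<in> g ` verts H"
  shows "i = j"
proof (rule ccontr)
  assume "i \<noteq> j"
  note slot_i = image_closed_at_Part[OF meets_i] and slot_j = image_closed_at_Part[OF meets_j]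
  have "fst i \<noteq> fst j"
    using \<open>i \<noteq> j\<close> slot_i(3) slot_j(3) by (simp add: prod_eq_iff)
  then have "d \<ge> 2"
    using distinct_slots_imp_d_ge_2 slot_i(1) slot_j(1) by blast
  have "\<not> fst j \<subseteq> fst i"
    using \<open>fst i \<noteq> fst j\<close> slotsD[OF slot_i(1)] slotsD[OF slot_j(1)] card_subset_eq by metis
  then obtain k where "k \<in> fst j" "k \<notin> fst i"
    by blast
  have "Terminal k \<in> block j"
    using \<open>k \<in> fst j\<close> by (simp add: block_eq[OF slot_j(1)])
  then have "insert (Terminal k) (insert (Part j z) (block i)) \<subseteq> g ` verts H"
    using image_contains_block[OF meets_i \<open>d \<ge> 2\<close>] image_contains_block[OF meets_j \<open>d \<ge> 2\<close>]
      meets_j by blast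
  then have "card (insert (Terminal k) (insert (Part j z) (block i))) \<le> card (verts H)"
    using card_mono simple_graph_finite_verts[OF simple_H] card_image_verts_H
    by (metis finite_imageI)
  moreover have "Terminal k \<notin> block i" "Part j z \<notin> block i"
    using \<open>k \<notin> fst i\<close> \<open>i \<noteq> j\<close> by (auto simp: block_eq[OF slot_i(1)])
  ultimately show False
    using card_block[OF slot_i(1)] finite_block by simp
qed

lemma image_vertex_in_block:
  assumes "u \<in> g ` verts H"
  obtains i y where "Part i y \<in> g ` verts H" "u \<in> block i"
proof (cases u)
  case (Terminal k)
  obtain x where "x \<in> verts H" and g_x: "g x = Terminal k"
    using assms Terminal by force
  obtain x' where "x' \<in> neighbors H x"
    using neighbors_H_nonempty[OF \<open>x \<in> verts H\<close>] by blast
  then have "g x' \<in> neighbors host (Terminal k)"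
    using mono_embedding_image_neighbors[OF embedding, of x] g_x by auto
  then obtain i y where "g x' = Part i y" "i \<in> slots" "k \<in> fst i"
    by (rule neighbors_host_Terminal)
  moreover have "x' \<in> verts H"
    using \<open>x' \<in> neighbors H x\<close> neighbors_subset_verts[OF simple_H]
    by blast
  ultimately show thesis
    using that Terminal by (metis UnI1 block_eq imageI)
next
  case (Part i y)
  then show thesis
    using that assms image_closed_at_Part[of i y] by (simp add: block_eq)
qed

lemma no_mono_embedding: False
proof -
  have "g v \<in> g ` verts H"
    using root_in_H by simp
  then obtain i y where meets_i: "Part i y \<in> g ` verts H"
    by (rule image_vertex_in_block)
  have "g ` verts H \<subseteq> block i"
  proof
    fix u assume "u \<in> g ` verts H"
    then obtain j z where "Part j z \<in> g ` verts H" "u \<in> block j"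
      by (rule image_vertex_in_block)
    then show "u \<in> block i"
      using image_meets_unique_slot[OF meets_i] by blast
  qed
  then have "card (verts H) \<le> card (verts H) - 1"
    using card_mono[OF finite_block] card_image_verts_H card_block[OF image_closed_at_Part(1)[OF meets_i]]
    by metis
  moreover have "card (verts H) > 0"
    using root_in_H simple_graph_finite_verts[OF simple_H] by (auto simp: card_gt_0_iff)
  ultimately show False
    by linarith
qed

end

lemma host_no_mono_copy: "\<not> has_mono_copy host_coloring host H"
  using has_mono_copyE no_mono_embedding by blast

lemma apex_not_in_host: "apex \<notin> verts host"
  by (auto simp: host_def)

lemma terminals_subset_host: "terminals \<subseteq> verts host"
  by (auto simp: host_def)

lemma place_image_edge:
  assumes "i \<in> slots" "e \<in> edges H" "v \<notin> e"
  shows "place i ` e \<in> edges host" "host_coloring (place i ` e) = snd i"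
proof -
  obtain x y where "e = {x, y}" "y \<in> outer" "x \<in> neighbors H y"
    using assms(2,3) by (rule edge_avoiding_rootE)
  then have "place i ` e = {place i x, Part i y}"
    by (simp add: place_outer)
  then show "place i ` e \<in> edges host" "host_coloring (place i ` e) = snd i"
    using host_edgeI[OF assms(1) \<open>y \<in> outer\<close> \<open>x \<in> neighbors H y\<close>] host_coloring_edge by simp_all
qed

lemma apex_not_in_image_place:
  assumes "i \<in> slots"
  shows "apex \<notin> place i ` verts H"
proof
  assume "apex \<in> place i ` verts H"
  then obtain x where "x \<in> N" "labelling (fst i) x = 2 * d - 1"
    by (auto simp: place_def split: if_splits)
  then have "2 * d - 1 \<in> fst i"
    using bij_betwE[OF bij_betw_labelling[OF assms]] by force
  then show False
    using slotsD(1)[OF assms] by auto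
qed

lemma mono_embedding_host_with_apex:
  assumes agree: "\<forall>e \<in> edges host. c e = host_coloring e"
    and slot: "(S, b) \<in> slots" and star: "\<forall>k \<in> S. c {Terminal k, apex} = b"
  shows "mono_embedding c b ((place (S, b))(v := apex)) H (add_vertex apex terminals host)"
proof -
  let ?g = "(place (S, b))(v := apex)" and ?F = "add_vertex apex terminals host"
  have "inj_on ?g (verts H)"
    using inj_on_place[OF slot] apex_not_in_image_place[OF slot] by (rule inj_on_fun_updI)
  moreover have "?g ` verts H \<subseteq> verts ?F"
    using block_subset_host[OF slot] by (auto simp: block_def add_vertex_def)
  moreover have "?g ` e \<in> edges ?F \<and> c (?g ` e) = b" if edge: "e \<in> edges H" for e
  proof (cases "v \<in> e")
    case True
    with simple_H edge obtain x where "x \<in> N" and e_eq: "e = {x, v}"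
      by (rule incident_edgeE)
    have "labelling S x \<in> S"
      using bij_betwE[OF bij_betw_labelling[OF slot]] \<open>x \<in> N\<close> by simp
    moreover have "?g x = Terminal (labelling S x)"
      using \<open>x \<in> N\<close> not_in_own_neighbors[OF simple_H, of v] by (auto simp: place_N)
    then have "?g ` e = {Terminal (labelling S x), apex}"
      by (simp only: e_eq image_insert image_empty fun_upd_same)
    ultimately show ?thesis
      using slotsD(1)[OF slot] star by (auto simp: add_vertex_def)
  next
    case False
    then have "?g ` e = place (S, b) ` e"
      by (simp only: fun_upd_image if_False)
    then show ?thesis
      using place_image_edge[OF slot edge False] agree by (simp add: add_vertex_def)
  qed
  ultimately show ?thesis
    by (simp add: mono_embedding_def)
qed

lemma host_with_apex_has_mono_copy:
  assumes agree: "\<forall>e \<in> edges host. c e = host_coloring e"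
  shows "has_mono_copy c (add_vertex apex terminals host) H"
proof -
  obtain S b where "S \<subseteq> {..<2 * d - 1}" "card S = d" and star: "\<forall>k\<in>S. c {Terminal k, apex} = b"
    using ex_monochromatic_subset[of "{..<2 * d - 1}" d "\<lambda>k. c {Terminal k, apex}"] by auto
  then have "(S, b) \<in> slots"
    by (simp add: slots_def)
  with agree have "mono_embedding c b ((place (S, b))(v := apex)) H (add_vertex apex terminals host)"
    using star by (rule mono_embedding_host_with_apex)
  then show ?thesis
    using simple_graph_add_vertex[OF simple_host apex_not_in_host terminals_subset_host] simple_H
    by (intro has_mono_copyI)
qed

lemma ex_critical_vertex:
  assumes "has_BEL_gadgets H"
  obtains F :: "nat sgraph" and w where "critical_vertex F H w" "vdegree F w = 2 * d - 1"
proof -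
  obtain F :: "nat sgraph" and w where "critical_vertex F H w" "vdegree F w = card terminals"
    using BEL_gadgets_critical_vertex[OF assms simple_H simple_host host_no_mono_copy
        apex_not_in_host terminals_subset_host host_with_apex_has_mono_copy] by blast
  moreover have "card terminals = 2 * d - 1"
    by (simp add: card_image inj_on_def)
  ultimately show thesis
    using that by simp
qed

end

theorem theorem4p2:
  fixes H :: "'a sgraph" and d :: nat
  assumes "d \<ge> 1"
    and "simple_graph H"
    and "regular_graph d H"
    and "has_BEL_gadgets H"
    and "\<exists>v \<in> verts H. independent_set H (neighbors H v) \<and>
           connected_graph (delete_verts H ({v} \<union> neighbors H v))"
  shows "ramsey_s H = 2 * d - 1"
proof (rule antisym)
  obtain v where "v \<in> verts H" and rooted: "rooted_regular_graph H v d"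
    using assms by (auto simp: rooted_regular_graph_def)
  obtain F :: "nat sgraph" and w where critical: "critical_vertex F H w" and degree: "vdegree F w = 2 * d - 1"
    using rooted_regular_graph.ex_critical_vertex[OF rooted assms(4)] by blast
  show "ramsey_s H \<le> 2 * d - 1"
    using ramsey_s_le_vdegree[OF critical] degree by simp
  show "2 * d - 1 \<le> ramsey_s H"
  proof (rule ramsey_s_ge[OF assms(2)])
    show "verts H \<noteq> {}"
      using \<open>v \<in> verts H\<close> by blast
    show "d \<le> vdegree H x" if "x \<in> verts H" for x
      using assms(3) that by (simp add: regular_graph_def)
    show "simple_graph F" "arrows F H"
      using critical by (simp_all add: critical_vertex_def)
  qed
qed

end
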